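(* Consider the pendulum swing-up problem with optimal value function $$J^*(x_0)=\min_{u(\cdot)}\int_0^{+\infty}c(x(t),u(t))\,dt\quad\text{subject to } x(0)=x_0,\ u(t)\in\mathbb{U},\ \dot x(t)=f(x(t),u(t)),$$ the minimum being over admissible controls. Let $\mathcal{L}:=\{x\in\mathbb{R}^2\mid J_\infty(x)\le\varepsilon\}$, where $J_\infty$ is the local LQR value function and $\varepsilon>0$ is sufficiently small that $\mathcal{L}$ is a region of attraction for $x_{\mathrm U}$ using the local LQR controller within the control bounds $\mathbb{U}$. For $x\in\mathbb{R}^2$ let $T_x>0$ be the time taken by the optimal controller to enter the region $\mathcal{L}$ from the initial state $x$. Let $\delta,\epsilon$ be constants ($\epsilon$ being distinct from $\varepsilon$). If $J$ is a $C^1$ function on $\mathbb{R}^2$ such that (i) $|J(x)-J_\infty(x)|\le\delta$ for every $x\in\mathcal{L}$; (ii) there exists a continuous function $l:\mathbb{R}^2\to\mathbb{R}$ such that $$\min_{u\in\mathbb{U}}\left\{c(x,u)+\frac{\partial J}{\partial x}(x)^{\mathsf T}f(x,u)\right\}=l(x),\qquad |l(x)|<\epsilon,\qquad\forall x\in\mathbb{R}^2;$$ (iii) for every $x_0\in\mathbb{R}^2$ there exists an admissible trajectory $(x(t),u(t))$ starting from $x(0)=x_0$ that attains cost $J(x_0)$, i.e. $\int_0^{+\infty}c(x(t),u(t))\,dt=J(x_0)$; then for every $x\in\mathbb{R}^2$ $$J^*(x)\le J(x)\le J^*(x)+\epsilon\,T_x+\delta+\varepsilon.$$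
   Context: State: $x=[\theta,\dot\theta]^{\mathsf T}\in\mathbb{R}^2$ (with $\theta\in\mathbb{R}$ not reduced modulo $2\pi$). Dynamics: $$\dot x=f(x,u)=\begin{bmatrix}\dot\theta\\ -\frac{1}{ml^2}\left(b\dot\theta-mgl\sin\theta-u\right)\end{bmatrix},$$ where $m>0$ is the mass, $l>0$ the pole length, $b\ge 0$ the damping coefficient, $g>0$ the gravity constant, and $u\in\mathbb{R}$ the torque (the function $l(x)$ in the claim is unrelated to the length $l$). Running cost: $c(x,u)=q_1\sin^2\theta+q_1(\cos\theta-1)^2+q_2\dot\theta^2+ru^2$ with $q_1,q_2,r>0$. Control set: $\mathbb{U}$ is either $\mathbb{R}$ or $[-u_{\max},u_{\max}]$ with $0<u_{\max}<mgl$. Upright positions: $x_{\mathrm U}=[2k\pi,0]^{\mathsf T}$, $k\in\mathbb{Z}$. Admissible controls (standing assumption): a control $u(t)$ with values in $\mathbb{U}$ is admissible if (i) it is piecewise continuous, and (ii) the resulting state trajectory satisfies $x(t)\to x_{\mathrm U}$ (one of the upright positions) as $t\to+\infty$. An admissible trajectory is a solution of $\dot x=f(x,u)$ under an admissible control. An optimal controller is an admissible control attaining the minimum defining $J^*$; the minimum is understood to be attained. Local LQR: linearize $\dot x\approx A(x-x_{\mathrm U})+Bu$ with $A=\frac{\partial f}{\partial x}(x_{\mathrm U},0)$, $B=\frac{\partial f}{\partial u}(x_{\mathrm U},0)$, and approximate the cost quadratically near $(x_{\mathrm U},0)$ by $(x-x_{\mathrm U})^{\mathsf T}Q(x-x_{\mathrm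 U})+ru^2$ with $Q=\mathrm{diag}(q_1,q_2)$. The local LQR value function is $J_\infty(x)=(x-x_{\mathrm U})^{\mathsf T}P(x-x_{\mathrm U})$, where $P\succ0$ is the unique positive definite solution of $A^{\mathsf T}P+PA-\frac1r PBB^{\mathsf T}P+Q=0$ ($A,B,P$ do not depend on $k$). The local LQR controller is $u=-\frac1r B^{\mathsf T}P(x-x_{\mathrm U})$. Since $x_{\mathrm U}$ ranges over all $[2k\pi,0]^{\mathsf T}$, $\mathcal{L}$ is the union over $k\in\mathbb{Z}$ of the (for small $\varepsilon$, disjoint) ellipses $\{(x-x_{\mathrm U})^{\mathsf T}P(x-x_{\mathrm U})\le\varepsilon\}$, and on each ellipse $J_\infty$ is defined with the corresponding $x_{\mathrm U}$. *)

theory Defs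
  imports "HOL-Analysis.Analysis"
begin

text \<open>
  The fields are, in order, $m, l, b, g$ (dynamics) and $q_1, q_2, r$ (running cost).
\<close>

record pendulum =
  mass :: real
  pole_length :: real
  damping :: real
  gravity :: real
  angle_weight :: real
  velocity_weight :: real
  torque_weight :: real

definition valid_pendulum :: "pendulum \<Rightarrow> bool" where
  "valid_pendulum p \<longleftrightarrow>
     mass p > 0 \<and> pole_length p > 0 \<and> damping p \<ge> 0 \<and> gravity p > 0 \<and>
     angle_weight p > 0 \<and> velocity_weight p > 0 \<and> torque_weight p > 0"

definition valid_control_set :: "pendulum \<Rightarrow> real set \<Rightarrow> bool" where
  "valid_control_set p U \<longleftrightarrow>
     U = UNIV \<or>
     (\<exists>umax. 0 < umax \<and> umax < mass p * gravity p * pole_length p \<and> U = {-umax..umax})"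

text \<open>A state is $x = (\theta, \dot\theta)$, with the angle not reduced modulo $2\pi$.\<close>

definition dynamics :: "pendulum \<Rightarrow> real^2 \<Rightarrow> real \<Rightarrow> real^2" where
  "dynamics p x u = vector [x$2,
     - (1 / (mass p * (pole_length p)\<^sup>2)) *
       (damping p * x$2 - mass p * gravity p * pole_length p * sin (x$1) - u)]"

definition running_cost :: "pendulum \<Rightarrow> real^2 \<Rightarrow> real \<Rightarrow> real" where
  "running_cost p x u =
     angle_weight p * (sin (x$1))\<^sup>2 + angle_weight p * (cos (x$1) - 1)\<^sup>2 +
     velocity_weight p * (x$2)\<^sup>2 + torque_weight p * u\<^sup>2"

definition upright :: "int \<Rightarrow> real^2" where
  "upright k = vector [2 * of_int k * pi, 0]"


subsection \<open>Admissible trajectories and the optimal value function\<close>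

text \<open>
  Piecewise continuity on $[0,\infty)$: finitely many discontinuities in every bounded interval,
  and finite one-sided limits everywhere.  Values at negative times are irrelevant.
\<close>

definition pw_continuous :: "(real \<Rightarrow> real) \<Rightarrow> bool" where
  "pw_continuous u \<longleftrightarrow>
     (\<forall>T. finite {t \<in> {0..T}. \<not> continuous (at t within {0..}) u}) \<and>
     (\<forall>t\<ge>0. \<exists>L. (u \<longlongrightarrow> L) (at_right t)) \<and>
     (\<forall>t>0. \<exists>L. (u \<longlongrightarrow> L) (at_left t))"

text \<open>
  For a piecewise continuous control, a solution of the state equation is a continuous function
  satisfying the equation at every time at which the control is continuous.
\<close>

definition solves :: "pendulum \<Rightarrow> (real \<Rightarrow> real^2) \<Rightarrow> (real \<Rightarrow> real) \<Rightarrow> bool" where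
  "solves p \<xi> u \<longleftrightarrow>
     continuous_on {0..} \<xi> \<and>
     (\<forall>t\<ge>0. continuous (at t within {0..}) u \<longrightarrow>
        (\<xi> has_vector_derivative dynamics p (\<xi> t) (u t)) (at t within {0..}))"

definition admissible_trajectory ::
    "pendulum \<Rightarrow> real set \<Rightarrow> real^2 \<Rightarrow> (real \<Rightarrow> real^2) \<Rightarrow> (real \<Rightarrow> real) \<Rightarrow> bool" where
  "admissible_trajectory p U x\<^sub>0 \<xi> u \<longleftrightarrow>
     pw_continuous u \<and> (\<forall>t\<ge>0. u t \<in> U) \<and>
     solves p \<xi> u \<and> \<xi> 0 = x\<^sub>0 \<and>
     (\<exists>k. (\<xi> \<longlongrightarrow> upright k) at_top)"

text \<open>
  The running cost is nonnegative, so its integral over $[0,\infty)$ always exists in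
  $[0,\infty]$; it is viewed as an extended real so that it can be compared with $J$, whose
  values are not assumed to be nonnegative.
\<close>

definition total_cost :: "pendulum \<Rightarrow> (real \<Rightarrow> real^2) \<Rightarrow> (real \<Rightarrow> real) \<Rightarrow> ereal" where
  "total_cost p \<xi> u =
     enn2ereal (\<integral>\<^sup>+t\<in>{0..}. ennreal (running_cost p (\<xi> t) (u t)) \<partial>lborel)"

definition optimal_value :: "pendulum \<Rightarrow> real set \<Rightarrow> real^2 \<Rightarrow> ereal" where
  "optimal_value p U x\<^sub>0 = Inf {total_cost p \<xi> u |\<xi> u. admissible_trajectory p U x\<^sub>0 \<xi> u}"

definition optimal_trajectory ::
    "pendulum \<Rightarrow> real set \<Rightarrow> real^2 \<Rightarrow> (real \<Rightarrow> real^2) \<Rightarrow> (real \<Rightarrow> real) \<Rightarrow> bool" where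
  "optimal_trajectory p U x\<^sub>0 \<xi> u \<longleftrightarrow>
     admissible_trajectory p U x\<^sub>0 \<xi> u \<and> total_cost p \<xi> u = optimal_value p U x\<^sub>0"

definition entry_time :: "(real^2) set \<Rightarrow> (real \<Rightarrow> real^2) \<Rightarrow> real" where
  "entry_time R \<xi> = Inf {t. 0 \<le> t \<and> \<xi> t \<in> R}"


subsection \<open>The local linear-quadratic regulator\<close>

text \<open>
  The linearization is the same at every upright position (see \<open>jacobian_upright\<close> and
  \<open>input_derivative_upright\<close> below), so it is taken at \<^term>\<open>upright 0\<close>.
\<close>

definition lin_A :: "pendulum \<Rightarrow> real^2^2" where
  "lin_A p = jacobian (\<lambda>x. dynamics p x 0) (at (upright 0))"

definition lin_B :: "pendulum \<Rightarrow> real^1^2" where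
  "lin_B p = columnvector (vector_derivative (\<lambda>u. dynamics p (upright 0) u) (at 0))"

definition cost_Q :: "pendulum \<Rightarrow> real^2^2" where
  "cost_Q p = vector [vector [angle_weight p, 0], vector [0, velocity_weight p]]"

definition positive_definite :: "real^2^2 \<Rightarrow> bool" where
  "positive_definite P \<longleftrightarrow> transpose P = P \<and> (\<forall>v. v \<noteq> 0 \<longrightarrow> v \<bullet> (P *v v) > 0)"

text \<open>\<open>is_lqr_matrix p P\<close>: $P \succ 0$ and $A^T P + P A - \frac1r P B B^T P + Q = 0$.\<close>

definition is_lqr_matrix :: "pendulum \<Rightarrow> real^2^2 \<Rightarrow> bool" where
  "is_lqr_matrix p P \<longleftrightarrow>
     positive_definite P \<and>
     transpose (lin_A p) ** P + P ** lin_A p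
       - (1 / torque_weight p) *\<^sub>R (P ** lin_B p ** transpose (lin_B p) ** P)
       + cost_Q p = 0"

definition lqr_value :: "real^2^2 \<Rightarrow> int \<Rightarrow> real^2 \<Rightarrow> real" where
  "lqr_value P k x = (x - upright k) \<bullet> (P *v (x - upright k))"

definition lqr_control :: "pendulum \<Rightarrow> real^2^2 \<Rightarrow> int \<Rightarrow> real^2 \<Rightarrow> real" where
  "lqr_control p P k x =
     - (1 / torque_weight p) * ((transpose (lin_B p) ** P) *v (x - upright k)) $ 1"

definition lqr_ellipse :: "real^2^2 \<Rightarrow> real \<Rightarrow> int \<Rightarrow> (real^2) set" where
  "lqr_ellipse P \<epsilon> k = {x. lqr_value P k x \<le> \<epsilon>}"

definition lqr_region :: "real^2^2 \<Rightarrow> real \<Rightarrow> (real^2) set" where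
  "lqr_region P \<epsilon> = (\<Union>k. lqr_ellipse P \<epsilon> k)"

text \<open>
  From every point of every ellipse the closed loop under the corresponding local LQR controller
  stays within the control bounds and converges to the centre of that ellipse.  The closed-loop
  vector field is globally Lipschitz, so the solution is unique; consequently this also forces
  the ellipses to be pairwise disjoint.
\<close>

definition lqr_region_of_attraction ::
    "pendulum \<Rightarrow> real set \<Rightarrow> real^2^2 \<Rightarrow> real \<Rightarrow> bool" where
  "lqr_region_of_attraction p U P \<epsilon> \<longleftrightarrow>
     (\<forall>k. \<forall>x\<^sub>0 \<in> lqr_ellipse P \<epsilon> k. \<exists>\<xi>.
        \<xi> 0 = x\<^sub>0 \<and>
        (\<forall>t\<ge>0. (\<xi> has_vector_derivative dynamics p (\<xi> t) (lqr_control p P k (\<xi> t)))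
                  (at t within {0..})) \<and>
        (\<forall>t\<ge>0. lqr_control p P k (\<xi> t) \<in> U) \<and>
        (\<xi> \<longlongrightarrow> upright k) at_top)"


subsection \<open>Explicit form of the linearization\<close>

lemma jacobian_upright:
  "jacobian (\<lambda>x. dynamics p x 0) (at (upright k)) =
     vector [vector [0, 1],
             vector [mass p * gravity p * pole_length p / (mass p * (pole_length p)\<^sup>2),
                     - damping p / (mass p * (pole_length p)\<^sup>2)]]"
proof -
  define c where "c = mass p * (pole_length p)\<^sup>2"
  define G where "G = mass p * gravity p * pole_length p"
  define d where "d = damping p"
  define M :: "real^2^2" where "M = vector [vector [0, 1], vector [G / c, - d / c]]"
  have cos1: "cos (upright k $ 1) = 1"
    using cos_int_2pin[of k] by (simp add: upright_def mult_ac)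
  have comp: "((\<lambda>x. x $ i) has_derivative (\<lambda>h. h $ i)) F" for i :: 2 and F :: "(real^2) filter"
    by (rule bounded_linear.has_derivative[OF bounded_linear_vec_nth has_derivative_ident])
  have split: "vector [a, b] = a *\<^sub>R axis 1 1 + b *\<^sub>R (axis 2 1 :: real^2)" for a b :: real
    by (simp add: vec_eq_iff forall_2 axis_def)
  have sin': "((\<lambda>x::real^2. sin (x $ 1)) has_derivative (\<lambda>h. h $ 1 * 1)) (at (upright k))"
    using has_derivative_sin[OF comp[of 1 "at (upright k)"]] unfolding cos1 .
  have second: "((\<lambda>x::real^2. - (1 / c) * (d * x $ 2 - G * sin (x $ 1) - 0))
      has_derivative (\<lambda>h. - (1 / c) * (d * h $ 2 - G * (h $ 1 * 1) - 0))) (at (upright k))"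
    by (intro has_derivative_mult_right has_derivative_diff has_derivative_const comp sin')
  have "((\<lambda>x. dynamics p x 0) has_derivative
      (\<lambda>h. h $ 2 *\<^sub>R axis 1 1 + (- (1 / c) * (d * h $ 2 - G * (h $ 1 * 1) - 0)) *\<^sub>R axis 2 1))
      (at (upright k))"
    unfolding dynamics_def split c_def[symmetric] G_def[symmetric] d_def[symmetric]
    by (intro has_derivative_add has_derivative_scaleR_left comp second)
  also have "(\<lambda>h. h $ 2 *\<^sub>R axis 1 1 + (- (1 / c) * (d * h $ 2 - G * (h $ 1 * 1) - 0)) *\<^sub>R axis 2 1) =
      (\<lambda>h. M *v h)"
    unfolding split[symmetric]
    by (rule ext) (simp add: M_def vec_eq_iff forall_2 matrix_vector_mult_def sum_2 diff_divide_distrib)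
  finally have "frechet_derivative (\<lambda>x. dynamics p x 0) (at (upright k)) = (\<lambda>h. M *v h)"
    using frechet_derivative_at by metis
  then show ?thesis
    by (simp add: jacobian_def M_def c_def G_def d_def)
qed

lemma input_derivative_upright:
  "vector_derivative (\<lambda>u. dynamics p (upright k) u) (at 0) =
     vector [0, 1 / (mass p * (pole_length p)\<^sup>2)]"
proof -
  have "sin (2 * of_int k * pi :: real) = 0"
    using sin_int_2pin[of k] by (simp add: mult_ac)
  then have "(\<lambda>u. dynamics p (upright k) u) =
      (\<lambda>u. u *\<^sub>R vector [0, 1 / (mass p * (pole_length p)\<^sup>2)])"
    by (auto simp: dynamics_def upright_def vec_eq_iff forall_2)
  moreover have "((\<lambda>u. u *\<^sub>R v) has_vector_derivative v) (at 0)" for v :: "real^2"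
    by (auto intro!: derivative_eq_intros)
  ultimately show ?thesis by (simp add: vector_derivative_at)
qed

end

theory Submission
  imports Defs
begin

text \<open>
  The lower bound holds because \<open>J x\<close> is itself the cost of an admissible trajectory.  For the upper
  bound, \<open>J\<close> is an approximate subsolution of the Hamilton--Jacobi--Bellman equation: since the
  residual is at least \<open>- \<epsilon>\<close>, along \<^emph>\<open>any\<close> admissible trajectory
  \<open>d/dt J(\<xi> t) \<ge> - c(\<xi> t, u t) - \<epsilon>\<close>.  Integrating up to time \<open>t\<close> yields
  \<open>J(\<xi> 0) \<le> J(\<xi> t) + (cost paid so far) + \<epsilon> t\<close> (lemma \<open>value_le_along_trajectory\<close>).
  Apply this to an optimal trajectory, at a time \<open>t\<close> at which it lies in the terminal region: there
  \<open>J \<le> J\<^sub>\<infinity> + \<delta> \<le> \<epsilon>\<^sub>L + \<delta>\<close>, and the cost paid so far is at most the optimal value.  Such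
  times exist because the trajectory converges to an interior point of the region
  (lemma \<open>admissible_trajectory_enters_region\<close>), and they come arbitrarily close to the entry time.
\<close>

lemma running_cost_nonneg:
  "valid_pendulum p \<Longrightarrow> 0 \<le> running_cost p x u"
  by (simp add: valid_pendulum_def running_cost_def)

lemma countable_discontinuities:
  assumes "pw_continuous u"
  shows "countable {t. 0 \<le> t \<and> \<not> continuous (at t within {0..}) u}"
proof -
  have "{t. 0 \<le> t \<and> \<not> continuous (at t within {0..}) u} =
      (\<Union>n::nat. {t \<in> {0..real n}. \<not> continuous (at t within {0..}) u})"
    using real_arch_simple by auto
  moreover have "finite {t \<in> {0..real n}. \<not> continuous (at t within {0..}) u}" for n :: nat
    using assms by (simp add: pw_continuous_def)
  ultimately show ?thesis
    by (simp add: countable_finite)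
qed

text \<open>
  Only countably many discontinuities can occur, which makes the cost rate Borel measurable.  This is
  what identifies the Lebesgue integral in the total cost with a gauge integral, to which
  the fundamental theorem of calculus applies.
\<close>

lemma running_cost_measurable:
  assumes "pw_continuous u" and "continuous_on {0..} \<xi>"
  shows "(\<lambda>t. indicator {0..} t * running_cost p (\<xi> t) (u t)) \<in> borel_measurable borel"
    (is "?F \<in> _")
proof (rule borel_measurable_continuous_countable_exceptions)
  let ?X = "insert 0 {t. 0 \<le> t \<and> \<not> continuous (at t within {0..}) u}"
  show "countable ?X"
    using countable_discontinuities[OF assms(1)] by simp
  have "isCont ?F t" if "t \<in> - ?X" for t
  proof (cases "t < 0")
    case True
    have "\<forall>\<^sub>F s in nhds t. ?F s = 0"
      using eventually_nhds_in_open[OF open_lessThan, of t 0] True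
      by (auto elim!: eventually_mono)
    then show ?thesis
      using isCont_cong[of ?F "\<lambda>_. 0" t] by simp
  next
    case False
    with that have t: "0 < t" "continuous (at t within {0..}) u" by auto
    have "t \<in> interior {0..}"
      using t(1) by (simp add: interior_real_atLeast)
    then have at: "at t within {0..} = at t"
      by (rule at_within_interior)
    have "isCont u t" using t(2) at by simp
    moreover have "continuous (at t within {0..}) \<xi>"
      using assms(2) t(1) by (simp add: continuous_on_eq_continuous_within)
    then have "isCont \<xi> t" using at by simp
    ultimately have "isCont (\<lambda>s. running_cost p (\<xi> s) (u s)) t"
      unfolding running_cost_def by (intro continuous_intros)
    moreover have "\<forall>\<^sub>F s in nhds t. ?F s = running_cost p (\<xi> s) (u s)"
      using eventually_nhds_in_open[OF open_greaterThan, of t 0] t(1)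
      by (auto elim!: eventually_mono)
    ultimately show ?thesis
      using isCont_cong[of ?F "\<lambda>s. running_cost p (\<xi> s) (u s)" t] by simp
  qed
  then show "continuous_on (- ?X) ?F"
    by (intro continuous_at_imp_continuous_on) blast
qed

lemma integral_cost_le_total_cost:
  assumes "valid_pendulum p" and "pw_continuous u" and "continuous_on {0..} \<xi>"
    and total: "total_cost p \<xi> u = ereal R"
  shows "(\<lambda>s. running_cost p (\<xi> s) (u s)) integrable_on {0..t}"
    and "integral {0..t} (\<lambda>s. running_cost p (\<xi> s) (u s)) \<le> R"
proof -
  let ?c = "\<lambda>s. running_cost p (\<xi> s) (u s)"
  let ?F = "\<lambda>s. indicator {0..} s * ?c s"
  have F_nonneg: "0 \<le> ?F s" for s
    by (simp add: running_cost_nonneg[OF assms(1)])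
  have R: "0 \<le> R"
    using total enn2ereal_nonneg unfolding total_cost_def by (metis ereal_less_eq(5))
  have "(\<integral>\<^sup>+s. ennreal (?F s) \<partial>lborel) = (\<integral>\<^sup>+s\<in>{0..}. ennreal (?c s) \<partial>lborel)"
    by (intro nn_integral_cong) (simp split: split_indicator)
  also have "\<dots> = ennreal R"
    using total unfolding total_cost_def by (metis e2ennreal_enn2ereal e2ennreal_ereal)
  finally have F_int: "(?F has_integral R) UNIV"
    using running_cost_measurable[OF assms(2,3)] F_nonneg R
    by (intro nn_integral_has_integral) auto
  have sub: "?F integrable_on {0..t}"
    using integrable_on_subinterval[OF has_integral_integrable[OF F_int]] by simp
  then show "?c integrable_on {0..t}"
    by (rule integrable_eq) simp
  have "integral {0..t} ?c = integral {0..t} ?F"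
    by (rule integral_cong) simp
  also have "\<dots> \<le> integral UNIV ?F"
    using sub F_int F_nonneg by (intro integral_subset_le) (auto intro: has_integral_integrable)
  also have "\<dots> = R"
    using F_int by (rule integral_unique)
  finally show "integral {0..t} ?c \<le> R" .
qed

text \<open>
  Integrated form of the one-sided inequality \<open>c + \<nabla>J \<bullet> f \<ge> - \<epsilon>\<close>.  The finitely many times in
  \<open>[0, t]\<close> at which the control jumps, and hence the state equation may fail, do not affect the
  fundamental theorem of calculus, because \<open>J \<circ> \<xi>\<close> stays continuous there.
\<close>

lemma value_le_along_trajectory:
  fixes J :: "real^2 \<Rightarrow> real"
  assumes "pw_continuous u" and "\<And>t. 0 \<le> t \<Longrightarrow> u t \<in> U" and "solves p \<xi> u"
    and J: "\<And>x. GDERIV J x :> gradJ x"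
    and subsolution: "\<And>x v. v \<in> U \<Longrightarrow> - \<epsilon> \<le> running_cost p x v + gradJ x \<bullet> dynamics p x v"
    and t: "0 \<le> t" and cost: "(\<lambda>s. running_cost p (\<xi> s) (u s)) integrable_on {0..t}"
  shows "J (\<xi> 0) \<le> J (\<xi> t) + integral {0..t} (\<lambda>s. running_cost p (\<xi> s) (u s)) + \<epsilon> * t"
proof -
  let ?c = "\<lambda>s. running_cost p (\<xi> s) (u s)"
  let ?D = "\<lambda>s. gradJ (\<xi> s) \<bullet> dynamics p (\<xi> s) (u s)"
  let ?S = "{s \<in> {0..t}. \<not> continuous (at s within {0..}) u}"
  have cont: "continuous_on {0..} \<xi>"
    using assms(3) by (simp add: solves_def)
  have J_deriv: "(J has_derivative (\<lambda>h. h \<bullet> gradJ x)) (at x)" for x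
    using J[of x] by (simp add: gderiv_def)
  have J_cont: "continuous_on UNIV J"
    by (intro continuous_at_imp_continuous_on ballI has_derivative_continuous[OF J_deriv])
  have deriv: "((\<lambda>s. J (\<xi> s)) has_vector_derivative ?D s) (at s)" if "s \<in> {0<..<t} - ?S" for s
  proof -
    have "(\<xi> has_vector_derivative dynamics p (\<xi> s) (u s)) (at s within {0..})"
      using assms(3) that by (auto simp: solves_def)
    moreover have "at s within {0..} = at s"
      using that by (intro at_within_interior) (simp add: interior_real_atLeast)
    ultimately have "(\<xi> has_vector_derivative dynamics p (\<xi> s) (u s)) (at s)"
      by simp
    then have "((J \<circ> \<xi>) has_vector_derivative dynamics p (\<xi> s) (u s) \<bullet> gradJ (\<xi> s)) (at s)"
      by (rule vector_derivative_diff_chain_within) (rule has_derivative_at_withinI[OF J_deriv])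
    then show ?thesis
      by (simp add: o_def inner_commute)
  qed
  have "(?D has_integral (J (\<xi> t) - J (\<xi> 0))) {0..t}"
  proof (rule fundamental_theorem_of_calculus_interior_strong[OF _ t deriv])
    show "finite ?S"
      using assms(1) by (simp add: pw_continuous_def)
    show "continuous_on {0..t} (\<lambda>s. J (\<xi> s))"
      by (rule continuous_on_compose2[OF J_cont continuous_on_subset[OF cont]]) auto
  qed
  then have rate: "((\<lambda>s. ?c s + ?D s) has_integral
      (integral {0..t} ?c + (J (\<xi> t) - J (\<xi> 0)))) {0..t}"
    by (intro has_integral_add integrable_integral[OF cost])
  have const: "((\<lambda>s. - \<epsilon>) has_integral (- \<epsilon> * t)) {0..t}"
    using has_integral_const_real[of "- \<epsilon>" 0 t] t by (simp add: mult.commute)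
  have "- \<epsilon> * t \<le> integral {0..t} ?c + (J (\<xi> t) - J (\<xi> 0))"
    by (rule has_integral_le[OF const rate], rule subsolution, rule assms(2)) simp
  then show ?thesis by simp
qed

lemma admissible_trajectory_enters_region:
  assumes "admissible_trajectory p U x \<xi> u" and "0 < \<epsilon>"
  shows "\<exists>t\<ge>0. \<xi> t \<in> lqr_region P \<epsilon>"
proof -
  obtain k where "(\<xi> \<longlongrightarrow> upright k) at_top"
    using assms(1) by (auto simp: admissible_trajectory_def)
  moreover have "isCont (lqr_value P k) (upright k)"
    unfolding lqr_value_def
    by (intro continuous_intros bounded_linear.isCont[OF matrix_vector_mul_bounded_linear])
  ultimately have "((\<lambda>t. lqr_value P k (\<xi> t)) \<longlongrightarrow> lqr_value P k (upright k)) at_top"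
    by (rule isCont_tendsto_compose[rotated])
  moreover have "lqr_value P k (upright k) < \<epsilon>"
    using assms(2) by (simp add: lqr_value_def)
  ultimately have "\<forall>\<^sub>F t in at_top. lqr_value P k (\<xi> t) < \<epsilon>"
    by (rule order_tendstoD)
  then have "\<forall>\<^sub>F t in at_top. 0 \<le> t \<and> lqr_value P k (\<xi> t) < \<epsilon>"
    using eventually_ge_at_top[of 0] by eventually_elim simp
  then obtain t where "0 \<le> t" "lqr_value P k (\<xi> t) < \<epsilon>"
    using eventually_happens'[OF trivial_limit_at_top_linorder] by blast
  then show ?thesis
    by (intro exI[of _ t]) (auto simp: lqr_region_def lqr_ellipse_def intro!: exI[of _ k])
qed

text \<open>
  The entry time is only an infimum: a bound that holds at all times spent in the region
  passes to it because the bound is affine and increasing in the time.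
\<close>

lemma le_at_entry_time:
  assumes "\<exists>t\<ge>0. \<xi> t \<in> L" and "0 < \<epsilon>"
    and bound: "\<And>t. 0 \<le> t \<Longrightarrow> \<xi> t \<in> L \<Longrightarrow> y \<le> a + \<epsilon> * t"
  shows "y \<le> a + \<epsilon> * entry_time L \<xi>"
proof -
  have "(y - a) / \<epsilon> \<le> entry_time L \<xi>"
    unfolding entry_time_def
  proof (rule cInf_greatest)
    show "{t. 0 \<le> t \<and> \<xi> t \<in> L} \<noteq> {}" using assms(1) by blast
    show "(y - a) / \<epsilon> \<le> t" if "t \<in> {t. 0 \<le> t \<and> \<xi> t \<in> L}" for t
      using bound[of t] that assms(2) by (simp add: pos_divide_le_eq mult.commute)
  qed
  then show ?thesis
    using assms(2) by (simp add: pos_divide_le_eq mult.commute)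
qed

theorem theorem4:
  fixes p :: pendulum and U :: "real set" and P :: "real^2^2"
    and \<epsilon>\<^sub>L \<epsilon> \<delta> :: real
    and J :: "real^2 \<Rightarrow> real" and gradJ :: "real^2 \<Rightarrow> real^2" and T :: "real^2 \<Rightarrow> real"
  assumes "valid_pendulum p" and "valid_control_set p U"
    and "is_lqr_matrix p P"
    and "\<epsilon>\<^sub>L > 0" and "lqr_region_of_attraction p U P \<epsilon>\<^sub>L"
    and T: "\<And>x. \<exists>\<xi> u. optimal_trajectory p U x \<xi> u \<and> T x = entry_time (lqr_region P \<epsilon>\<^sub>L) \<xi>"
    and C1: "\<And>x. GDERIV J x :> gradJ x" "continuous_on UNIV gradJ"
    and i: "\<And>k x. x \<in> lqr_ellipse P \<epsilon>\<^sub>L k \<Longrightarrow> \<bar>J x - lqr_value P k x\<bar> \<le> \<delta>"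
    and ii: "\<exists>l. continuous_on UNIV l \<and>
      (\<forall>x. (\<exists>u\<in>U. running_cost p x u + gradJ x \<bullet> dynamics p x u = l x) \<and>
           (\<forall>u\<in>U. l x \<le> running_cost p x u + gradJ x \<bullet> dynamics p x u) \<and>
           \<bar>l x\<bar> < \<epsilon>)"
    and iii: "\<And>x\<^sub>0. \<exists>\<xi> u. admissible_trajectory p U x\<^sub>0 \<xi> u \<and> total_cost p \<xi> u = ereal (J x\<^sub>0)"
  shows "\<forall>x. optimal_value p U x \<le> ereal (J x) \<and>
             ereal (J x) \<le> optimal_value p U x + ereal (\<epsilon> * T x + \<delta> + \<epsilon>\<^sub>L)"
proof
  fix x
  obtain l where l: "\<And>x v. v \<in> U \<Longrightarrow> l x \<le> running_cost p x v + gradJ x \<bullet> dynamics p x v"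
    "\<And>x. \<bar>l x\<bar> < \<epsilon>"
    using ii by blast
  have \<epsilon>: "0 < \<epsilon>"
    using l(2)[of x] by linarith
  have subsolution: "- \<epsilon> \<le> running_cost p y v + gradJ y \<bullet> dynamics p y v" if "v \<in> U" for y v
    using l(1)[OF that, of y] l(2)[of y] by linarith
  have lower: "optimal_value p U x \<le> ereal (J x)"
  proof -
    obtain \<xi> u where "admissible_trajectory p U x \<xi> u" "total_cost p \<xi> u = ereal (J x)"
      using iii by blast
    then show ?thesis
      unfolding optimal_value_def by (intro Inf_lower) force
  qed
  obtain \<xi> u where opt: "optimal_trajectory p U x \<xi> u"
    and Tx: "T x = entry_time (lqr_region P \<epsilon>\<^sub>L) \<xi>"
    using T by blast
  have adm: "admissible_trajectory p U x \<xi> u"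
    using opt by (simp add: optimal_trajectory_def)
  then have traj: "pw_continuous u" "\<And>t. 0 \<le> t \<Longrightarrow> u t \<in> U" "solves p \<xi> u" "\<xi> 0 = x"
    by (auto simp: admissible_trajectory_def)
  have cont: "continuous_on {0..} \<xi>"
    using traj(3) by (simp add: solves_def)
  have "0 \<le> total_cost p \<xi> u"
    by (simp add: total_cost_def)
  then have "0 \<le> optimal_value p U x"
    using opt by (simp add: optimal_trajectory_def)
  with lower obtain R where R: "optimal_value p U x = ereal R"
    by (cases "optimal_value p U x") auto
  then have total: "total_cost p \<xi> u = ereal R"
    using opt by (simp add: optimal_trajectory_def)
  note cost = integral_cost_le_total_cost[OF \<open>valid_pendulum p\<close> traj(1) cont total]
  have "J x \<le> (R + \<delta> + \<epsilon>\<^sub>L) + \<epsilon> * entry_time (lqr_region P \<epsilon>\<^sub>L) \<xi>"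
  proof (rule le_at_entry_time[OF admissible_trajectory_enters_region[OF adm \<open>\<epsilon>\<^sub>L > 0\<close>] \<epsilon>])
    fix t :: real
    assume t: "0 \<le> t" and "\<xi> t \<in> lqr_region P \<epsilon>\<^sub>L"
    then obtain k where k: "\<xi> t \<in> lqr_ellipse P \<epsilon>\<^sub>L k"
      by (auto simp: lqr_region_def)
    have "J (\<xi> t) \<le> \<delta> + \<epsilon>\<^sub>L"
      using i[OF k] k by (simp add: lqr_ellipse_def)
    moreover have "J x \<le> J (\<xi> t) + integral {0..t} (\<lambda>s. running_cost p (\<xi> s) (u s)) + \<epsilon> * t"
      using value_le_along_trajectory[OF traj(1-3) C1(1) subsolution t cost(1)] traj(4) by simp
    ultimately show "J x \<le> (R + \<delta> + \<epsilon>\<^sub>L) + \<epsilon> * t"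
      using cost(2)[of t] by linarith
  qed
  then show "optimal_value p U x \<le> ereal (J x) \<and>
      ereal (J x) \<le> optimal_value p U x + ereal (\<epsilon> * T x + \<delta> + \<epsilon>\<^sub>L)"
    using lower by (simp add: R Tx algebra_simps)
qed

end
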